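(* Let $G$ be a finite connected graph with at least two vertices and maximum degree $k$. Then $q(G\boxtimes K_{k+1})=2$, where $\boxtimes$ is the strong product and $K_{k+1}$ is the complete graph on $k+1$ vertices.
   Context: For a finite simple graph $G$ on vertex set $\{1,\dots,n\}$, $\mathcal{S}(G)$ denotes the set of real symmetric $n\times n$ matrices $A=[a_{ij}]$ such that for $i\neq j$, $a_{ij}\neq 0$ if and only if $ij$ is an edge of $G$ (diagonal entries are unrestricted). For a symmetric matrix $A$, $q(A)$ is the number of distinct eigenvalues of $A$, and $q(G)=\min\{q(A): A\in\mathcal{S}(G)\}$. The strong product $G\boxtimes H$ is the graph on $V(G)\times V(H)$ with edges $(g,h)(g,h')$ for $hh'\in E(H)$, $(g,h)(g',h)$ for $gg'\in E(G)$, and $(g,h)(g',h')$ for $gg'\in E(G)$ and $hh'\in E(H)$. *)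

theory Defs
  imports "Graph_Theory.Graph_Theory" "Jordan_Normal_Form.Char_Poly"
begin

text \<open>
  Finite simple graphs are the \<^locale>\<open>pair_graph\<close>s: finite, loop-free digraphs
  whose arc relation is symmetric, an edge \<open>uv\<close> being the two arcs \<open>(u, v)\<close> and \<open>(v, u)\<close>.
  The degree of a vertex is thus its \<^const>\<open>out_degree\<close>.
\<close>

text \<open>
  Matrices have index set \<open>{0..<n}\<close>, so the vertices have to be numbered by some \<open>f\<close>. All
  numberings are admitted: this closes the set of matrices under simultaneous permutation of
  rows and columns, which changes neither the graph (up to isomorphism) nor the eigenvalues.
\<close>

definition graph_mats :: "'a pair_pre_digraph \<Rightarrow> real mat set" where
  "graph_mats G = {A. \<exists>n f. n = card (pverts G) \<and> bij_betw f {0..<n} (pverts G) \<and>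
     A \<in> carrier_mat n n \<and> transpose_mat A = A \<and>
     (\<forall>i<n. \<forall>j<n. i \<noteq> j \<longrightarrow> (A $$ (i, j) \<noteq> 0 \<longleftrightarrow> (f i, f j) \<in> parcs G))}"

definition q_mat :: "real mat \<Rightarrow> nat" where
  "q_mat A = card {x. eigenvalue A x}"

definition q_graph :: "'a pair_pre_digraph \<Rightarrow> nat" where
  "q_graph G = (INF A \<in> graph_mats G. q_mat A)"

definition strong_product ::
    "'a pair_pre_digraph \<Rightarrow> 'b pair_pre_digraph \<Rightarrow> ('a \<times> 'b) pair_pre_digraph"
    (infixl \<open>\<boxtimes>\<close> 70) where
  "G \<boxtimes> H = \<lparr> pverts = pverts G \<times> pverts H,
     parcs = {((g, h), (g, h')) | g h h'. g \<in> pverts G \<and> (h, h') \<in> parcs H}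
           \<union> {((g, h), (g', h)) | g g' h. (g, g') \<in> parcs G \<and> h \<in> pverts H}
           \<union> {((g, h), (g', h')) | g g' h h'. (g, g') \<in> parcs G \<and> (h, h') \<in> parcs H} \<rparr>"

definition max_degree :: "'a pair_pre_digraph \<Rightarrow> nat" where
  "max_degree G = Max (out_degree (with_proj G) ` pverts G)"

end

theory Submission
  imports Defs "Jordan_Normal_Form.Schur_Decomposition"
begin

text \<open>
  The upper bound needs a symmetric involution \<open>A\<close> with the pattern of \<open>G \<boxtimes> K\<close>. Give every vertex
  \<open>v\<close> of \<open>G\<close> the space \<open>\<real>\<^sup>K\<close> of dimension \<open>k + 1\<close> with an orthonormal basis \<open>q\<^sub>c\<close> of vectors without
  zero entries. As \<open>v\<close> has at most \<open>k\<close> neighbours, each edge at \<open>v\<close> can reserve a basis vector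
  of its own, with at least one left over. Let \<open>A\<close> swap the two vectors reserved by each edge
  and negate the unreserved ones. The block of an edge is then \<open>q\<^sub>c q\<^sub>d\<^sup>T\<close>, without zero entries, and
  the block of a vertex is minus the projection onto the span of a nonempty proper part of the
  basis; the basis is chosen such that all such projections have nonzero off-diagonal entries.

  Conversely, a real symmetric matrix with a single eigenvalue is scalar.
\<close>

section \<open>Spectra of real symmetric matrices\<close>

lemma transpose_eq_index:
  assumes "A \<in> carrier_mat n n" "transpose_mat A = A" "i < n" "j < n"
  shows "A $$ (i, j) = A $$ (j, i)"
  using assms index_transpose_mat(1)[of i A j] by auto

text \<open>Moving the matrix across the form \<open>v \<bullet>c v\<close>, which is nonzero, turns
  \<mu> into its conjugate, so \<mu> is real. A real root of the complex characteristic polynomial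
  is a root of the real one.\<close>

lemma eigenvalue_symmetric_of_real:
  fixes B :: "real mat"
  assumes B: "B \<in> carrier_mat n n" and sym: "transpose_mat B = B"
    and ev: "eigenvalue (map_mat complex_of_real B) \<mu>"
  shows "\<exists>r. \<mu> = of_real r \<and> eigenvalue B r"
proof -
  let ?C = "map_mat complex_of_real B"
  have C: "?C \<in> carrier_mat n n" using B by simp
  obtain v where v: "v \<in> carrier_vec n" "v \<noteq> 0\<^sub>v n" and Cv: "?C *\<^sub>v v = \<mu> \<cdot>\<^sub>v v"
    using ev B unfolding eigenvalue_def eigenvector_def by auto
  have cv: "conjugate v \<in> carrier_vec n" using v by simp
  have "conjugate (?C *\<^sub>v v) = ?C *\<^sub>v conjugate v"
    using B v by (intro eq_vecI) (auto simp: scalar_prod_def)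
  then have Ccv: "?C *\<^sub>v conjugate v = cnj \<mu> \<cdot>\<^sub>v conjugate v"
    unfolding Cv conjugate_smult_vec by simp
  have symC: "transpose_mat ?C = ?C"
    unfolding map_mat_transpose sym ..
  have "\<mu> * (v \<bullet>c v) = (?C *\<^sub>v v) \<bullet>c v"
    unfolding Cv using v by simp
  also have "\<dots> = v \<bullet> (?C *\<^sub>v conjugate v)"
    using transpose_vec_mult_scalar[OF C cv v(1)] unfolding symC .
  also have "\<dots> = cnj \<mu> * (v \<bullet>c v)"
    unfolding Ccv using v by simp
  finally have "\<mu> = cnj \<mu>"
    using v by simp
  then have re: "\<mu> = of_real (Re \<mu>)"
    by (metis Reals_cnj_iff of_real_Re)
  have "poly (char_poly ?C) \<mu> = 0"
    using ev eigenvalue_root_char_poly[OF C] by simp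
  then have "complex_of_real (poly (char_poly B) (Re \<mu>)) = 0"
    using re unfolding of_real_hom.char_poly_hom[OF B] by (metis of_real_hom.poly_map_poly)
  then have "eigenvalue B (Re \<mu>)"
    using eigenvalue_root_char_poly[OF B] by simp
  with re show ?thesis by blast
qed

lemma sum_diag_mult_commute:
  fixes X Y :: "'a :: comm_ring_1 mat"
  assumes "X \<in> carrier_mat n n" "Y \<in> carrier_mat n n"
  shows "(\<Sum>i<n. (X * Y) $$ (i, i)) = (\<Sum>i<n. (Y * X) $$ (i, i))"
proof -
  have "(\<Sum>i<n. (X * Y) $$ (i, i)) = (\<Sum>i<n. \<Sum>j<n. X $$ (i, j) * Y $$ (j, i))"
    using assms by (simp add: scalar_prod_def atLeast0LessThan)
  also have "\<dots> = (\<Sum>j<n. \<Sum>i<n. Y $$ (j, i) * X $$ (i, j))"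
    by (subst sum.swap) (simp add: mult.commute)
  also have "\<dots> = (\<Sum>i<n. (Y * X) $$ (i, i))"
    using assms by (simp add: scalar_prod_def atLeast0LessThan)
  finally show ?thesis .
qed

text \<open>The trace of \<open>B\<^sup>2\<close> is the sum of the squares of the entries of \<open>B\<close>, but it is also
  the sum of the squares of the complex eigenvalues.\<close>

lemma symmetric_zero_spectrum:
  fixes B :: "real mat"
  assumes B: "B \<in> carrier_mat n n" and sym: "transpose_mat B = B"
    and ev: "\<And>r. eigenvalue B r \<Longrightarrow> r = 0"
  shows "B = 0\<^sub>m n n"
proof -
  let ?C = "map_mat complex_of_real B"
  have C: "?C \<in> carrier_mat n n" using B by simp
  \<comment> \<open>Over the complex numbers the characteristic polynomial splits, as the Schur
    decomposition requires.\<close>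
  obtain es where es: "char_poly ?C = (\<Prod>a\<leftarrow>es. [:- a, 1:])"
    using char_poly_factorized[OF C] by auto
  obtain U P Q where "schur_decomposition ?C es = (U, P, Q)"
    by (rule prod_cases3)
  from schur_decomposition[OF C es this]
  have wit: "similar_mat_wit ?C U P Q" and tri: "upper_triangular U" and diag: "diag_mat U = es"
    by auto
  have cs: "U \<in> carrier_mat n n" "P \<in> carrier_mat n n" "Q \<in> carrier_mat n n"
    and QP: "Q * P = 1\<^sub>m n" and CPUQ: "?C = P * U * Q"
    using similar_mat_witD2[OF C wit] by blast+
  \<comment> \<open>The diagonal of \<open>U\<close> consists of eigenvalues, which are all zero
    here, so \<open>U\<close> is strictly upper triangular.\<close>
  have U0: "U $$ (i, j) = 0" if "i < n" "j \<le> i" for i j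
  proof (cases "j = i")
    case True
    have "U $$ (i, i) \<in> set es"
      using that cs unfolding diag[symmetric] diag_mat_def by auto
    then have "poly (char_poly ?C) (U $$ (i, i)) = 0"
      unfolding es by (auto simp: poly_prod_list prod_list_zero_iff)
    then have "eigenvalue ?C (U $$ (i, i))"
      using eigenvalue_root_char_poly[OF C] by simp
    from eigenvalue_symmetric_of_real[OF B sym this] show ?thesis
      using ev True by auto
  qed (use that tri cs in \<open>auto simp: upper_triangular_def\<close>)
  have "complex_of_real (\<Sum>i<n. \<Sum>j<n. (B $$ (i, j))\<^sup>2) = (\<Sum>i<n. (?C * ?C) $$ (i, i))"
  proof -
    have "(?C * ?C) $$ (i, i) = (\<Sum>j<n. complex_of_real ((B $$ (i, j))\<^sup>2))" if "i < n" for i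
      using that B transpose_eq_index[OF B sym]
      by (auto simp: scalar_prod_def atLeast0LessThan power2_eq_square intro!: sum.cong)
    then show ?thesis by simp
  qed
  also have "?C * ?C = P * (U * U * Q)"
  proof -
    have "?C * ?C = P * U * (Q * P) * U * Q"
      unfolding CPUQ using cs by (simp add: assoc_mult_mat[of _ n n _ n _ n])
    also have "\<dots> = P * (U * U * Q)"
      unfolding QP using cs by (simp add: assoc_mult_mat[of _ n n _ n _ n])
    finally show ?thesis .
  qed
  also have "(\<Sum>i<n. (P * (U * U * Q)) $$ (i, i)) = (\<Sum>i<n. (U * U * Q * P) $$ (i, i))"
    using cs by (intro sum_diag_mult_commute) auto
  also have "U * U * Q * P = U * U"
    using cs QP by (simp add: assoc_mult_mat[of _ n n _ n _ n])
  also have "(\<Sum>i<n. (U * U) $$ (i, i)) = (\<Sum>i<n. \<Sum>j<n. U $$ (i, j) * U $$ (j, i))"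
    using cs by (simp add: scalar_prod_def atLeast0LessThan)
  \<comment> \<open>In each product one of the two factors lies on or below the diagonal of
    \<open>U\<close>.\<close>
  also have "\<dots> = 0"
    by (intro sum.neutral ballI) (metis U0 lessThan_iff mult_eq_0_iff nat_le_linear)
  finally have "(\<Sum>i<n. \<Sum>j<n. (B $$ (i, j))\<^sup>2) = 0"
    by (simp only: of_real_eq_0_iff)
  then have "\<forall>i<n. \<forall>j<n. B $$ (i, j) = 0"
    by (simp add: sum_nonneg_eq_0_iff sum_nonneg)
  then show ?thesis using B by (intro eq_matI) auto
qed

text \<open>If \<open>l\<close> were the only eigenvalue, \<open>A - l I\<close> would be symmetric
  with no eigenvalue other than 0, hence zero, and \<open>A\<close> would be diagonal.\<close>

lemma q_mat_ge_2:
  assumes A: "A \<in> carrier_mat n n" and sym: "transpose_mat A = A"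
    and ij: "i < n" "j < n" "i \<noteq> j" and nz: "A $$ (i, j) \<noteq> 0"
  shows "q_mat A \<ge> 2"
proof (rule ccontr)
  assume less: "\<not> q_mat A \<ge> 2"
  have "char_poly A \<noteq> 0"
    using degree_monic_char_poly[OF A] by auto
  then have fin: "finite {x. eigenvalue A x}"
    unfolding eigenvalue_root_char_poly[OF A] by (rule poly_roots_finite)
  have "card {x. eigenvalue A x} \<le> 1"
    using less unfolding q_mat_def by simp
  \<comment> \<open>If the spectrum were empty, any \<open>l\<close> would do.\<close>
  then obtain l where l: "\<And>x. eigenvalue A x \<Longrightarrow> x = l"
    using card_le_Suc0_iff_eq[OF fin] by (metis One_nat_def mem_Collect_eq)
  define B where "B = A + (- l) \<cdot>\<^sub>m 1\<^sub>m n"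
  have B: "B \<in> carrier_mat n n"
    using A unfolding B_def by simp
  have symB: "transpose_mat B = B"
    by (rule eq_matI) (use A transpose_eq_index[OF A sym] in \<open>auto simp: B_def\<close>)
  have "r = 0" if ev: "eigenvalue B r" for r
  proof -
    obtain v where v: "v \<in> carrier_vec n" "v \<noteq> 0\<^sub>v n" and Bv: "B *\<^sub>v v = r \<cdot>\<^sub>v v"
      using ev B unfolding eigenvalue_def eigenvector_def by auto
    have "((- l) \<cdot>\<^sub>m 1\<^sub>m n) *\<^sub>v v = (- l) \<cdot>\<^sub>v v"
      using v by (intro eq_vecI) (auto simp: row_smult)
    then have "B *\<^sub>v v = A *\<^sub>v v + (- l) \<cdot>\<^sub>v v"
      unfolding B_def using A v by (simp add: add_mult_distrib_mat_vec[of _ n n])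
    then have "A *\<^sub>v v + (- l) \<cdot>\<^sub>v v = r \<cdot>\<^sub>v v"
      using Bv by simp
    then have *: "(A *\<^sub>v v) $ m = (r + l) * v $ m" if "m < n" for m
      using that A v by (auto dest!: arg_cong[of _ _ "\<lambda>w. w $ m"] simp: algebra_simps)
    have "A *\<^sub>v v = (r + l) \<cdot>\<^sub>v v"
      using * A v by (intro eq_vecI) auto
    then have "eigenvalue A (r + l)"
      using A v unfolding eigenvalue_def eigenvector_def by auto
    from l[OF this] show ?thesis by simp
  qed
  from symmetric_zero_spectrum[OF B symB this] have "B $$ (i, j) = 0"
    using ij by simp
  then show False
    using ij nz A unfolding B_def by simp
qed

text \<open>Applying \<open>A\<close> twice to an eigenvector shows that the square of the
  eigenvalue is 1.\<close>

lemma q_mat_involution_le_2: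
  assumes A: "A \<in> carrier_mat n n" and AA: "A * A = 1\<^sub>m n"
  shows "q_mat A \<le> 2"
proof -
  have "x = 1 \<or> x = - 1" if ev: "eigenvalue A x" for x
  proof -
    obtain v where v: "v \<in> carrier_vec n" "v \<noteq> 0\<^sub>v n" and Av: "A *\<^sub>v v = x \<cdot>\<^sub>v v"
      using ev A unfolding eigenvalue_def eigenvector_def by auto
    have "v = (A * A) *\<^sub>v v"
      unfolding AA using v by simp
    also have "\<dots> = (x * x) \<cdot>\<^sub>v v"
      using A v Av by (simp add: assoc_mult_mat_vec[of _ n n _ n] mult_mat_vec[of _ n n]
          smult_smult_assoc)
    finally have eq: "v = (x * x) \<cdot>\<^sub>v v" .
    obtain m where m: "m < n" "v $ m \<noteq> 0"
      using v by (metis carrier_vecD eq_vecI index_zero_vec)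
    have "v $ m = x * x * v $ m"
      using arg_cong[OF eq, of "\<lambda>w. w $ m"] m v by simp
    then have "x * x = 1" using m by simp
    then show ?thesis by (simp add: square_eq_1_iff)
  qed
  then have "{x. eigenvalue A x} \<subseteq> {1, - 1}" by auto
  then have "card {x. eigenvalue A x} \<le> card {1 :: real, - 1}"
    by (rule card_mono[rotated]) simp
  then show ?thesis by (simp add: q_mat_def)
qed

section \<open>An orthonormal basis without zero entries\<close>

text \<open>Constant weight 1 gives the sum \<open>card H\<close>. If that is even, raising one
  weight to 2 adds 3 and changes the parity.\<close>

lemma ex_odd_sum_squares:
  assumes "finite H" "H \<noteq> {}"
  shows "\<exists>s :: 'b \<Rightarrow> int. (\<forall>h. s h > 0) \<and> odd (\<Sum>h\<in>H. (s h)\<^sup>2)"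
proof (cases "odd (card H)")
  case True
  then show ?thesis by (intro exI[of _ "\<lambda>_. 1"]) simp
next
  case False
  obtain a where a: "a \<in> H" using assms by blast
  have "(\<Sum>h\<in>H. (if h = a then 2 else 1 :: int)\<^sup>2) = 4 + (\<Sum>h\<in>H - {a}. 1)"
    using assms a by (simp add: sum.remove)
  also have "\<dots> = 3 + int (card H)"
    using assms a by (simp add: card_Diff_singleton of_nat_diff card_gt_0_iff Suc_leI)
  finally have "odd (\<Sum>h\<in>H. (if h = a then 2 else 1 :: int)\<^sup>2)"
    using False by simp
  then show ?thesis
    by (intro exI[of _ "\<lambda>h. if h = a then 2 else 1"]) simp
qed

text \<open>One formula for two uses: with \<open>S\<close> the whole index set it shows that the
  reflection is an involution, and with a proper part it gives the entries of the projection onto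
  the span of the corresponding basis vectors.\<close>

lemma sum_reflection_mult:
  fixes s :: "'b \<Rightarrow> real"
  assumes "finite S"
  shows "(\<Sum>l\<in>S. (of_bool (i = l) - a * s i * s l) * (of_bool (l = j) - a * s l * s j)) =
    of_bool (i = j \<and> i \<in> S) +
    a * s i * s j * (a * (\<Sum>l\<in>S. (s l)\<^sup>2) - of_bool (i \<in> S) - of_bool (j \<in> S))"
proof -
  have "(\<Sum>l\<in>S. (of_bool (i = l) - a * s i * s l) * (of_bool (l = j) - a * s l * s j)) =
    (\<Sum>l\<in>S. (if l = i then of_bool (i = j) else 0) - (if l = i then a * s i * s j else 0)
      - (if l = j then a * s i * s j else 0) + a * a * s i * s j * (s l)\<^sup>2)"
    by (intro sum.cong) (auto simp: algebra_simps power2_eq_square)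
  also have "\<dots> = of_bool (i = j \<and> i \<in> S) - of_bool (i \<in> S) * (a * s i * s j)
      - of_bool (j \<in> S) * (a * s i * s j) + a * a * s i * s j * (\<Sum>l\<in>S. (s l)\<^sup>2)"
    using assms by (simp add: sum.distrib sum_subtractf sum_distrib_left)
  finally show ?thesis by (simp add: algebra_simps)
qed

text \<open>The matrix is the reflection \<open>I - 2 s s\<^sup>T / C\<close> with \<open>C = s\<^sup>T s\<close> for a positive integer
  vector \<open>s\<close>. Since \<open>C\<close> is odd, no partial sum of the \<open>s\<^sub>h\<^sup>2\<close> equals \<open>C / 2\<close>, which is what keeps
  the entries below away from zero.\<close>

lemma nowhere_zero_reflection:
  assumes fin: "finite H" and ne: "H \<noteq> {}"
  obtains Q :: "'b \<Rightarrow> 'b \<Rightarrow> real"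
  where "\<And>i j. Q i j = Q j i"
    and "\<And>i j. Q i j \<noteq> 0"
    and "\<And>i j. i \<in> H \<Longrightarrow> j \<in> H \<Longrightarrow> (\<Sum>l\<in>H. Q i l * Q l j) = of_bool (i = j)"
    and "\<And>S i j. S \<subseteq> H \<Longrightarrow> S \<noteq> {} \<Longrightarrow> S \<noteq> H \<Longrightarrow> i \<noteq> j \<Longrightarrow>
      (\<Sum>l\<in>S. Q i l * Q l j) \<noteq> 0"
proof -
  obtain t :: "'b \<Rightarrow> int" where t: "\<And>h. t h > 0" "odd (\<Sum>h\<in>H. (t h)\<^sup>2)"
    using ex_odd_sum_squares[OF assms] by blast
  define s where "s h = real_of_int (t h)" for h
  define W where "W S = (\<Sum>l\<in>S. (s l)\<^sup>2)" for S
  define a where "a = 2 / W H"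
  define Q where "Q i j = of_bool (i = j) - a * s i * s j" for i j
  have s: "s h > 0" for h using t by (simp add: s_def)
  have WH: "W H > 0"
    unfolding W_def using fin ne s by (intro sum_pos zero_less_power) auto
  have a: "a > 0" "a * W H = 2"
    using WH by (auto simp: a_def)
  have odd: "a * W S \<noteq> 1" for S
  proof
    assume "a * W S = 1"
    then have "2 * W S = W H"
      using WH by (simp add: a_def field_simps)
    then have "real_of_int (2 * (\<Sum>l\<in>S. (t l)\<^sup>2)) = real_of_int (\<Sum>l\<in>H. (t l)\<^sup>2)"
      unfolding W_def s_def by simp
    then have "2 * (\<Sum>l\<in>S. (t l)\<^sup>2) = (\<Sum>l\<in>H. (t l)\<^sup>2)"
      unfolding of_int_eq_iff .
    with t(2) show False by (metis dvd_triv_left)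
  qed
  have mult: "(\<Sum>l\<in>S. Q i l * Q l j) = of_bool (i = j \<and> i \<in> S) +
    a * s i * s j * (a * W S - of_bool (i \<in> S) - of_bool (j \<in> S))" if "finite S" for S i j
    unfolding Q_def W_def by (rule sum_reflection_mult[OF that])
  have nz: "a * s i * s j \<noteq> 0" for i j
    using a s[of i] s[of j] by simp
  show ?thesis
  proof (rule that[of Q])
    fix i j
    show "Q i j = Q j i" by (auto simp: Q_def)
    \<comment> \<open>A diagonal entry is 1 minus \<open>a * W {i}\<close>, so it is covered by the
      parity argument for the singleton.\<close>
    show "Q i j \<noteq> 0"
      using odd[of "{i}"] nz[of i j] by (cases "i = j") (auto simp: Q_def W_def power2_eq_square)
    show "(\<Sum>l\<in>H. Q i l * Q l j) = of_bool (i = j)" if "i \<in> H" "j \<in> H"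
      using that a by (simp add: mult[OF fin])
    fix S assume S: "S \<subseteq> H" "S \<noteq> {}" "S \<noteq> H" and "i \<noteq> j"
    have finS: "finite S" "finite (H - S)" using S fin by (auto intro: finite_subset)
    have "W S > 0"
      unfolding W_def using finS S s by (intro sum_pos zero_less_power) auto
    moreover have "W (H - S) > 0"
      unfolding W_def using finS S s by (intro sum_pos zero_less_power) auto
    moreover have "W H = W (H - S) + W S"
      unfolding W_def using S(1) fin by (rule sum.subset_diff)
    ultimately have "a * W S > 0" "a * W S < a * W H"
      using a(1) by simp_all
    \<comment> \<open>Since \<open>a * W S\<close> lies strictly between 0 and 2 and differs from 1,
      subtracting 0, 1 or 2 never gives 0.\<close>
    then have "a * W S - of_bool (i \<in> S) - of_bool (j \<in> S) \<noteq> 0"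
      using a odd[of S] by auto
    with nz[of i j] \<open>i \<noteq> j\<close> show "(\<Sum>l\<in>S. Q i l * Q l j) \<noteq> 0"
      by (simp add: mult[OF finS(1)])
  qed
qed

section \<open>Matrices indexed by the elements of a finite set\<close>

text \<open>The numbering \<open>f\<close> is kept apart from the kernel \<open>M\<close>, so that
  products can be computed as sums over vertices, where the block structure is visible.\<close>

definition kernel_mat :: "(nat \<Rightarrow> 'c) \<Rightarrow> nat \<Rightarrow> ('c \<Rightarrow> 'c \<Rightarrow> real) \<Rightarrow> real mat" where
  "kernel_mat f n M = mat n n (\<lambda>(i, j). M (f i) (f j))"

lemma kernel_mat_carrier [simp]: "kernel_mat f n M \<in> carrier_mat n n"
  by (simp add: kernel_mat_def)

lemma kernel_mat_index [simp]: "i < n \<Longrightarrow> j < n \<Longrightarrow> kernel_mat f n M $$ (i, j) = M (f i) (f j)"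
  by (simp add: kernel_mat_def)

lemma transpose_kernel_mat:
  assumes "\<And>x y. M x y = M y x"
  shows "transpose_mat (kernel_mat f n M) = kernel_mat f n M"
  by (rule eq_matI) (auto simp: kernel_mat_def assms)

lemma kernel_mat_mult:
  assumes "bij_betw f {0..<n} X"
  shows "kernel_mat f n L * kernel_mat f n M = kernel_mat f n (\<lambda>x z. \<Sum>y\<in>X. L x y * M y z)"
  by (rule eq_matI)
    (auto simp: kernel_mat_def scalar_prod_def sum.reindex_bij_betw[OF assms, symmetric])

lemma kernel_mat_eq_one:
  assumes "bij_betw f {0..<n} X" and "\<And>x y. x \<in> X \<Longrightarrow> y \<in> X \<Longrightarrow> M x y = of_bool (x = y)"
  shows "kernel_mat f n M = 1\<^sub>m n"
proof (rule eq_matI)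
  fix i j assume "i < dim_row (1\<^sub>m n :: real mat)" "j < dim_col (1\<^sub>m n :: real mat)"
  then have ij: "i < n" "j < n" by auto
  then have "f i \<in> X" "f j \<in> X" "f i = f j \<longleftrightarrow> i = j"
    using assms(1) by (auto simp: bij_betw_def inj_on_def)
  then show "kernel_mat f n M $$ (i, j) = 1\<^sub>m n $$ (i, j)"
    using ij by (simp add: assms(2))
qed (auto simp: kernel_mat_def)

text \<open>As \<open>R\<close> is its own inverse, \<open>R * P * R\<close> is a conjugate of
  \<open>P\<close>.\<close>

lemma mat_conj_involution:
  fixes R P :: "'a :: semiring_1 mat"
  assumes R: "R \<in> carrier_mat n n" and P: "P \<in> carrier_mat n n"
    and RR: "R * R = 1\<^sub>m n" and PP: "P * P = 1\<^sub>m n"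
  shows "R * P * R * (R * P * R) = 1\<^sub>m n"
proof -
  have mc: "X * Y \<in> carrier_mat n n" if "X \<in> carrier_mat n n" "Y \<in> carrier_mat n n" for X Y :: "'a mat"
    using that by (rule mult_carrier_mat)
  have "R * P * R * (R * P * R) = R * (P * ((R * R) * (P * R)))"
    using R P by (simp add: assoc_mult_mat[of _ n n _ n _ n] mc)
  also have "\<dots> = R * ((P * P) * R)"
    unfolding RR using R P by (simp add: assoc_mult_mat[of _ n n _ n _ n] mc)
  finally show ?thesis
    unfolding PP using R by (simp add: RR)
qed

lemma transpose_mat_conj:
  fixes R P :: "'a :: comm_semiring_1 mat"
  assumes "R \<in> carrier_mat n n" "P \<in> carrier_mat n n"
    and "transpose_mat R = R" "transpose_mat P = P"
  shows "transpose_mat (R * P * R) = R * P * R"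
proof -
  have "transpose_mat (R * P * R) = transpose_mat R * (transpose_mat P * transpose_mat R)"
    using assms(1,2) by (simp add: transpose_mult[of _ n n _ n] mult_carrier_mat[of _ n n])
  also have "\<dots> = R * P * R"
    unfolding assms(3,4) using assms(1,2) by (simp add: assoc_mult_mat[of _ n n _ n _ n])
  finally show ?thesis .
qed

section \<open>The involution with the pattern of the strong product\<close>

text \<open>\<open>\<phi> v u\<close> is the slot in the block of \<open>v\<close> that is reserved for the edge \<open>vu\<close>.\<close>

lemma ex_slot_involution:
  assumes sym: "\<And>u v. (u, v) \<in> E \<Longrightarrow> (v, u) \<in> E"
    and inj: "\<And>v. inj_on (\<phi> v) {u. (v, u) \<in> E}"
  shows "\<exists>\<sigma>. (\<forall>v u. (v, u) \<in> E \<longrightarrow> \<sigma> (v, \<phi> v u) = (u, \<phi> u v)) \<and>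
    (\<forall>v c. c \<notin> \<phi> v ` {u. (v, u) \<in> E} \<longrightarrow> \<sigma> (v, c) = (v, c)) \<and> (\<forall>x. \<sigma> (\<sigma> x) = x)"
proof -
  \<comment> \<open>By injectivity of \<open>\<phi> v\<close> a reserved slot determines its edge;
    it is sent to the slot reserved for that edge at the other end.\<close>
  define \<sigma> where "\<sigma> = (\<lambda>(v, c). if c \<in> \<phi> v ` {u. (v, u) \<in> E}
    then let u = the_inv_into {u. (v, u) \<in> E} (\<phi> v) c in (u, \<phi> u v) else (v, c))"
  have 1: "\<sigma> (v, \<phi> v u) = (u, \<phi> u v)" if "(v, u) \<in> E" for v u
    using that by (auto simp: \<sigma>_def the_inv_into_f_f[OF inj])
  have 2: "\<sigma> (v, c) = (v, c)" if "c \<notin> \<phi> v ` {u. (v, u) \<in> E}" for v c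
    using that by (simp add: \<sigma>_def)
  have 3: "\<sigma> (\<sigma> x) = x" for x
  proof (cases x)
    case (Pair v c)
    show ?thesis
    proof (cases "c \<in> \<phi> v ` {u. (v, u) \<in> E}")
      case True
      then obtain u where "(v, u) \<in> E" "c = \<phi> v u" by auto
      then show ?thesis using Pair 1 sym by simp
    qed (use Pair 2 in simp)
  qed
  from 1 2 3 show ?thesis by blast
qed

text \<open>The matrix is \<open>R * P * R\<close>, where \<open>R\<close> is block diagonal with a
  copy of \<open>Q\<close> for each vertex of \<open>G\<close>, and \<open>P\<close> is a signed
  permutation matrix of the slots. Entries can be read off because \<open>R\<close> vanishes between
  different vertices.\<close>

lemma ex_involution_graph_mats:
  assumes G: "pair_graph G"
    and nb: "\<And>v. v \<in> pverts G \<Longrightarrow> \<exists>u. (v, u) \<in> parcs G"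
    and deg: "\<And>v. v \<in> pverts G \<Longrightarrow> card {u. (v, u) \<in> parcs G} < card (pverts K)"
    and finK: "finite (pverts K)"
    and K: "parcs K = {(u, v). (u, v) \<in> pverts K \<times> pverts K \<and> u \<noteq> v}"
    and neK: "pverts K \<noteq> {}"
  shows "\<exists>A \<in> graph_mats (G \<boxtimes> K). A * A = 1\<^sub>m (dim_row A)"
proof -
  interpret G: pair_graph G by fact
  let ?V = "pverts G" and ?H = "pverts K" and ?E = "parcs G"
  define N where "N v = {u. (v, u) \<in> ?E}" for v
  have sym: "(v, u) \<in> ?E" if "(u, v) \<in> ?E" for u v
    using that G.arcs_symmetric by auto
  have NV: "N v \<subseteq> ?V" for v using G.in_arcsD2 by (auto simp: N_def)
  have finN: "finite (N v)" for v using NV G.pair_finite_verts by (rule finite_subset)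
  have EV: "u \<in> ?V" "v \<in> ?V" "u \<noteq> v" if "(u, v) \<in> ?E" for u v
    using that G.in_arcsD1 G.in_arcsD2 G.pair_no_loops[OF that] by auto
  \<comment> \<open>Off the vertex set \<open>N v\<close> is empty, so slots can be chosen for all
    \<open>v\<close> at once.\<close>
  have "\<exists>g. inj_on g (N v) \<and> g ` N v \<subseteq> ?H" for v
  proof (cases "v \<in> ?V")
    case True
    then show ?thesis
      using deg[OF True] by (subst inj_on_iff_card_le[OF finN finK]) (simp add: N_def)
  next
    case False
    then have "N v = {}" using EV by (auto simp: N_def)
    then show ?thesis by auto
  qed
  then obtain \<phi> where \<phi>: "\<And>v. inj_on (\<phi> v) (N v)" "\<And>v. \<phi> v ` N v \<subseteq> ?H" by metis
  have \<phi>H: "\<phi> v u \<in> ?H" if "(v, u) \<in> ?E" for v u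
    using \<phi>(2)[of v] that by (auto simp: N_def)
  obtain \<sigma> where \<sigma>1: "\<And>v u. (v, u) \<in> ?E \<Longrightarrow> \<sigma> (v, \<phi> v u) = (u, \<phi> u v)"
    and \<sigma>2: "\<And>v c. c \<notin> \<phi> v ` N v \<Longrightarrow> \<sigma> (v, c) = (v, c)" and \<sigma>\<sigma>: "\<And>x. \<sigma> (\<sigma> x) = x"
    using ex_slot_involution[of ?E \<phi>] sym \<phi>(1) unfolding N_def by metis
  have \<sigma>V: "\<sigma> x \<in> ?V \<times> ?H" if "x \<in> ?V \<times> ?H" for x
  proof (cases x)
    case (Pair v c)
    show ?thesis
    proof (cases "c \<in> \<phi> v ` N v")
      case True
      then obtain u where "(v, u) \<in> ?E" "c = \<phi> v u" by (auto simp: N_def)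
      then show ?thesis using Pair \<sigma>1 sym \<phi>H EV by simp
    qed (use Pair \<sigma>2 that in simp)
  qed
  obtain Q :: "'b \<Rightarrow> 'b \<Rightarrow> real" where Qsym: "\<And>i j. Q i j = Q j i"
    and Qnz: "\<And>i j. Q i j \<noteq> 0"
    and QQ: "\<And>i j. i \<in> ?H \<Longrightarrow> j \<in> ?H \<Longrightarrow> (\<Sum>l\<in>?H. Q i l * Q l j) = of_bool (i = j)"
    and Qsub: "\<And>S i j. S \<subseteq> ?H \<Longrightarrow> S \<noteq> {} \<Longrightarrow> S \<noteq> ?H \<Longrightarrow> i \<noteq> j \<Longrightarrow>
      (\<Sum>l\<in>S. Q i l * Q l j) \<noteq> 0"
  proof (rule nowhere_zero_reflection[OF finK neK], goal_cases)
    case (1 Q)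
    from 1(1)[OF 1(2-5)] show ?case .
  qed

  let ?X = "?V \<times> ?H"
  have finX: "finite ?X" using G.pair_finite_verts finK by simp
  define n where "n = card ?X"
  obtain f where f: "bij_betw f {0..<n} ?X"
    using ex_bij_betw_nat_finite[OF finX] unfolding n_def by blast
  define R where "R x y = of_bool (fst x = fst y) * Q (snd x) (snd y)" for x y :: "'a \<times> 'b"
  \<comment> \<open>The fixed points of \<sigma> are exactly the unreserved slots, because the ends
    of an edge differ.\<close>
  define \<epsilon> where "\<epsilon> x = (if \<sigma> x = x then - 1 else 1 :: real)" for x
  define P where "P x y = of_bool (\<sigma> x = y) * \<epsilon> x" for x y
  define A where "A = kernel_mat f n R * kernel_mat f n P * kernel_mat f n R"
  have \<epsilon>: "\<epsilon> (\<sigma> x) = \<epsilon> x" "\<epsilon> x * \<epsilon> x = 1" for x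
    by (auto simp: \<epsilon>_def \<sigma>\<sigma>)
  have Rsym: "R x y = R y x" for x y using Qsym by (auto simp: R_def)
  \<comment> \<open>Symmetry holds because \<sigma> is an involution and \<epsilon> is constant on
    its orbits.\<close>
  have Psym: "P x y = P y x" for x y
    unfolding P_def of_bool_def by (metis \<sigma>\<sigma> \<epsilon>(1) mult_zero_left)
  have RR: "kernel_mat f n R * kernel_mat f n R = 1\<^sub>m n"
    unfolding kernel_mat_mult[OF f]
  proof (rule kernel_mat_eq_one[OF f])
    fix x z assume xz: "x \<in> ?X" "z \<in> ?X"
    have "(\<Sum>y\<in>?X. R x y * R y z) = (\<Sum>v\<in>?V. \<Sum>c\<in>?H. R x (v, c) * R (v, c) z)"
      by (simp add: sum.cartesian_product)
    also have "\<dots> = (\<Sum>v\<in>?V. if v = fst x then of_bool (x = z) else 0)"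
      using xz QQ[of "snd x" "snd z"]
      by (intro sum.cong) (auto simp: R_def prod_eq_iff)
    also have "\<dots> = of_bool (x = z)"
      using xz G.pair_finite_verts by auto
    finally show "(\<Sum>y\<in>?X. R x y * R y z) = of_bool (x = z)" .
  qed
  have Psum: "(\<Sum>y\<in>?X. P x y * h y) = \<epsilon> x * h (\<sigma> x)" if "x \<in> ?X" for x h
  proof -
    have "(\<Sum>y\<in>?X. P x y * h y) = (\<Sum>y\<in>?X. if y = \<sigma> x then \<epsilon> x * h (\<sigma> x) else 0)"
      by (intro sum.cong) (auto simp: P_def)
    then show ?thesis using finX \<sigma>V[OF that] by simp
  qed
  have PP: "kernel_mat f n P * kernel_mat f n P = 1\<^sub>m n"
    unfolding kernel_mat_mult[OF f]
  proof (rule kernel_mat_eq_one[OF f])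
    fix x z assume "x \<in> ?X" "z \<in> ?X"
    then show "(\<Sum>y\<in>?X. P x y * P y z) = of_bool (x = z)"
      unfolding Psum[OF \<open>x \<in> ?X\<close>] by (simp add: P_def \<sigma>\<sigma> \<epsilon>)
  qed
  have A: "A \<in> carrier_mat n n"
    unfolding A_def by (intro mult_carrier_mat[of _ n n] kernel_mat_carrier)
  have AA: "A * A = 1\<^sub>m n"
    unfolding A_def by (rule mat_conj_involution[OF _ _ RR PP]) simp_all
  have symA: "transpose_mat A = A"
    unfolding A_def by (rule transpose_mat_conj[of _ n])
      (simp_all add: transpose_kernel_mat[of R, OF Rsym] transpose_kernel_mat[of P, OF Psym])
  \<comment> \<open>This is an entry of the product after both sums collapse: the left
    \<open>R\<close> keeps only the slots at the vertex of \<open>x\<close>, and \<open>P\<close>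
    moves each of them by \<sigma>.\<close>
  define T where "T x z = (\<Sum>c\<in>?H. Q (snd x) c * (\<epsilon> (fst x, c) * R (\<sigma> (fst x, c)) z))" for x z
  have AT: "A $$ (i, j) = T (f i) (f j)" if "i < n" "j < n" for i j
  proof -
    have fi: "f i \<in> ?X" using bij_betw_apply[OF f] that by simp
    have "A = kernel_mat f n R * (kernel_mat f n P * kernel_mat f n R)"
      unfolding A_def by (rule assoc_mult_mat[of _ n n _ n _ n]) simp_all
    then have "A $$ (i, j) = (\<Sum>x\<in>?X. R (f i) x * (\<Sum>y\<in>?X. P x y * R y (f j)))"
      using that by (simp add: kernel_mat_mult[OF f])
    also have "\<dots> = (\<Sum>x\<in>?X. R (f i) x * (\<epsilon> x * R (\<sigma> x) (f j)))"
      by (intro sum.cong refl) (simp only: Psum)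
    also have "\<dots> = (\<Sum>v\<in>?V. \<Sum>c\<in>?H. R (f i) (v, c) * (\<epsilon> (v, c) * R (\<sigma> (v, c)) (f j)))"
      by (simp add: sum.cartesian_product)
    also have "\<dots> = (\<Sum>v\<in>?V. if v = fst (f i) then T (f i) (f j) else 0)"
      by (intro sum.cong) (auto simp: R_def T_def)
    also have "\<dots> = T (f i) (f j)"
      using fi G.pair_finite_verts by auto
    finally show ?thesis .
  qed
  \<comment> \<open>Completeness of \<open>K\<close> merges the three kinds of arcs: over an edge of
    \<open>G\<close> any two slots are adjacent.\<close>
  have arc_prod: "((g, h), (g', h')) \<in> parcs (G \<boxtimes> K) \<longleftrightarrow> g = g' \<and> h \<noteq> h' \<or> (g, g') \<in> ?E"
    if "(g, h) \<in> ?X" "(g', h') \<in> ?X" for g h g' h'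
    using that unfolding strong_product_def by (auto simp: K)
  have pattern: "T (g, h) (g', h') \<noteq> 0 \<longleftrightarrow> g = g' \<and> h \<noteq> h' \<or> (g, g') \<in> ?E"
    if X: "(g, h) \<in> ?X" "(g', h') \<in> ?X" and ne: "(g, h) \<noteq> (g', h')" for g h g' h'
  proof (cases "g = g'")
    case True
    let ?S = "?H - \<phi> g ` N g"
    \<comment> \<open>A reserved slot is moved to another vertex, where \<open>R\<close> vanishes;
      an unreserved slot stays and contributes with sign -1.\<close>
    have "T (g, h) (g', h') = (\<Sum>c\<in>?H. if c \<in> ?S then - (Q h c * Q c h') else 0)"
      unfolding T_def
    proof (intro sum.cong refl)
      fix c assume c: "c \<in> ?H"
      show "Q (snd (g, h)) c * (\<epsilon> (fst (g, h), c) * R (\<sigma> (fst (g, h), c)) (g', h')) =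
          (if c \<in> ?S then - (Q h c * Q c h') else 0)"
      proof (cases "c \<in> ?S")
        case True
        then show ?thesis using \<sigma>2[of c g] \<open>g = g'\<close> by (simp add: \<epsilon>_def R_def)
      next
        case False
        then obtain u where "(g, u) \<in> ?E" "c = \<phi> g u" using c by (auto simp: N_def)
        then show ?thesis using \<sigma>1[of g u] EV[of g u] \<open>g = g'\<close> False by (auto simp: R_def)
      qed
    qed
    also have "\<dots> = - (\<Sum>c\<in>?S. Q h c * Q c h')"
      using finK by (simp add: sum.If_cases sum_negf Int_absorb1 set_diff_eq Int_def conj_commute)
    finally have T: "T (g, h) (g', h') = - (\<Sum>c\<in>?S. Q h c * Q c h')" .
    \<comment> \<open>The degree bound leaves some slot at \<open>g\<close> unreserved, and a
      neighbour of \<open>g\<close> reserves another, so \<open>?S\<close> is a nonempty proper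
      part.\<close>
    have "card (\<phi> g ` N g) < card ?H"
      using deg[of g] X card_image_le[OF finN[of g], of "\<phi> g"] by (simp add: N_def)
    then have "?S \<noteq> {}"
      by (metis Diff_eq_empty_iff card_mono finN finite_imageI not_less)
    moreover have "?S \<noteq> ?H"
      using nb[of g] X \<phi>H by (fastforce simp: N_def)
    ultimately have "(\<Sum>c\<in>?S. Q h c * Q c h') \<noteq> 0"
      using X ne True by (intro Qsub) auto
    then show ?thesis using T True ne by simp
  next
    case ne: False
    show ?thesis
    proof (cases "(g, g') \<in> ?E")
      case True
      let ?c = "\<phi> g g'"
      \<comment> \<open>Only the slot of \<open>g\<close> reserved for \<open>g'\<close> is moved to
        \<open>g'\<close>, so a single term survives; it is a product of two entries of
        \<open>Q\<close>.\<close>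
      have other: "R (\<sigma> (g, c)) (g', h') = 0" if "c \<noteq> ?c" for c
      proof (cases "c \<in> \<phi> g ` N g")
        case True
        then obtain u where "(g, u) \<in> ?E" "c = \<phi> g u" by (auto simp: N_def)
        then show ?thesis using \<sigma>1[of g u] that by (auto simp: R_def)
      qed (use \<sigma>2[of c g] ne in \<open>simp add: R_def\<close>)
      have "T (g, h) (g', h') =
          (\<Sum>c\<in>?H. if c = ?c then Q h ?c * (\<epsilon> (g, ?c) * R (\<sigma> (g, ?c)) (g', h')) else 0)"
        unfolding T_def using other by (intro sum.cong) auto
      also have "\<dots> = Q h ?c * Q (\<phi> g' g) h'"
        using finK \<phi>H[OF True] \<sigma>1[OF True] ne by (simp add: \<epsilon>_def R_def)
      also have "\<dots> \<noteq> 0"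
        using X Qnz \<phi>H[OF True] \<phi>H[OF sym[OF True]] by simp
      finally show ?thesis using True by simp
    next
      case False
      \<comment> \<open>Without an edge, no slot of \<open>g\<close> is moved to
        \<open>g'\<close>.\<close>
      have "R (\<sigma> (g, c)) (g', h') = 0" for c
      proof (cases "c \<in> \<phi> g ` N g")
        case True
        then obtain u where "(g, u) \<in> ?E" "c = \<phi> g u" by (auto simp: N_def)
        then show ?thesis using \<sigma>1[of g u] False by (auto simp: R_def)
      qed (use \<sigma>2[of c g] ne in \<open>simp add: R_def\<close>)
      then show ?thesis using False ne by (simp add: T_def)
    qed
  qed
  have pv: "pverts (G \<boxtimes> K) = ?X" by (simp add: strong_product_def)
  have "A $$ (i, j) \<noteq> 0 \<longleftrightarrow> (f i, f j) \<in> parcs (G \<boxtimes> K)" if "i < n" "j < n" "i \<noteq> j" for i j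
  proof -
    have "f i \<in> ?X" "f j \<in> ?X"
      using bij_betw_apply[OF f] that by simp_all
    moreover have "f i \<noteq> f j"
      using bij_betw_imp_inj_on[OF f] that by (auto simp: inj_on_def)
    ultimately show ?thesis
      using pattern[of "fst (f i)" "snd (f i)" "fst (f j)" "snd (f j)"]
        arc_prod[of "fst (f i)" "snd (f i)" "fst (f j)" "snd (f j)"] AT[OF that(1,2)]
      by simp
  qed
  then have "A \<in> graph_mats (G \<boxtimes> K)"
    unfolding graph_mats_def pv using A symA f n_def by blast
  with AA A show ?thesis by (auto intro!: bexI[of _ A])
qed

section \<open>The minimum number of eigenvalues\<close>

text \<open>The arc forces a nonzero off-diagonal entry in every admissible matrix, so 2 is a lower
  bound, and the involution attains it.\<close>

lemma q_graph_eq_2I: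
  assumes arc: "(u, v) \<in> parcs G" "u \<in> pverts G" "v \<in> pverts G" "u \<noteq> v"
    and A: "A \<in> graph_mats G" "A * A = 1\<^sub>m (dim_row A)"
  shows "q_graph G = 2"
proof -
  have ge: "q_mat B \<ge> 2" if B: "B \<in> graph_mats G" for B
  proof -
    obtain n f where f: "bij_betw f {0..<n} (pverts G)" and B: "B \<in> carrier_mat n n"
        "transpose_mat B = B"
      and pat: "\<And>i j. i < n \<Longrightarrow> j < n \<Longrightarrow> i \<noteq> j \<Longrightarrow> B $$ (i, j) \<noteq> 0 \<longleftrightarrow> (f i, f j) \<in> parcs G"
      using B unfolding graph_mats_def by auto
    have "u \<in> f ` {0..<n}" "v \<in> f ` {0..<n}"
      using f arc by (simp_all add: bij_betw_imp_surj_on)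
    then obtain i j where ij: "i < n" "j < n" "f i = u" "f j = v"
      by auto
    then have "i \<noteq> j" and "B $$ (i, j) \<noteq> 0"
      using arc pat[of i j] by auto
    with ij show ?thesis
      by (intro q_mat_ge_2[OF B])
  qed
  have "A \<in> carrier_mat (dim_row A) (dim_row A)"
    using A(1) unfolding graph_mats_def by auto
  from q_mat_involution_le_2[OF this A(2)] ge[OF A(1)] have "q_mat A = 2" by simp
  then show ?thesis
    unfolding q_graph_def using A(1) ge by (intro cInf_eq_minimum) (auto intro: rev_image_eqI)
qed

theorem theorem3p2:
  fixes G :: "'a pair_pre_digraph" and K :: "'b pair_pre_digraph" and k :: nat
  assumes "pair_graph G"
    and "Digraph_Component.connected (with_proj G)"
    and "card (pverts G) \<ge> 2"
    and "max_degree G = k"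
    and "complete_digraph (k + 1) (with_proj K)"
  shows "q_graph (G \<boxtimes> K) = 2"
proof -
  interpret G: pair_graph G by fact
  have K: "finite (pverts K)" "card (pverts K) = k + 1"
      "parcs K = {(u, v). (u, v) \<in> pverts K \<times> pverts K \<and> u \<noteq> v}"
    using assms(5) unfolding complete_digraph_pair_def by auto
  then have neK: "pverts K \<noteq> {}" by auto
  have nb: "\<exists>u. (v, u) \<in> parcs G" if v: "v \<in> pverts G" for v
  proof -
    obtain w where w: "w \<in> pverts G" "w \<noteq> v"
      using assms(3) v by (metis card_le_Suc0_iff_eq G.pair_finite_verts not_less_eq_eq numeral_2_eq_2)
    have "v \<rightarrow>\<^sup>*\<^bsub>with_proj (mk_symmetric (with_proj G))\<^esub> w"
      using assms(2) v w unfolding Digraph_Component.connected_def strongly_connected_def by auto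
    \<comment> \<open>The arcs of \<open>G\<close> are already symmetric, so the walk exists in
      \<open>G\<close>; as \<open>w\<close> differs from \<open>v\<close>, its first arc yields a
      neighbour.\<close>
    then have "v \<rightarrow>\<^sup>*\<^bsub>with_proj G\<^esub> w"
      using G.reachable_mk_symmetric_eq G.pair_sym_arcs by simp
    then show ?thesis
      using w by (cases rule: G.converse_reachable_cases) auto
  qed
  have deg: "card {u. (v, u) \<in> parcs G} < card (pverts K)" if "v \<in> pverts G" for v
  proof -
    have "out_arcs (with_proj G) v = Pair v ` {u. (v, u) \<in> parcs G}"
      by (auto simp: out_arcs_def)
    then have "out_degree (with_proj G) v = card {u. (v, u) \<in> parcs G}"
      by (simp add: out_degree_def card_image inj_on_def)
    moreover have "out_degree (with_proj G) v \<le> max_degree G"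
      unfolding max_degree_def using that G.pair_finite_verts by simp
    ultimately show ?thesis using assms(4) K(2) by simp
  qed
  obtain A where A: "A \<in> graph_mats (G \<boxtimes> K)" "A * A = 1\<^sub>m (dim_row A)"
    using ex_involution_graph_mats[OF assms(1) nb deg K(1) K(3) neK] by blast
  obtain v where "v \<in> pverts G"
    using assms(3) by fastforce
  with nb obtain u where vu: "(v, u) \<in> parcs G" by blast
  obtain h where h: "h \<in> pverts K" using neK by blast
  show ?thesis
  \<comment> \<open>For the lower bound, an arc of \<open>G\<close> is copied into the layer of
    \<open>h\<close>.\<close>
  proof (rule q_graph_eq_2I[OF _ _ _ _ A])
    show "((v, h), (u, h)) \<in> parcs (G \<boxtimes> K)"
      using vu h by (auto simp: strong_product_def)
    show "(v, h) \<in> pverts (G \<boxtimes> K)" "(u, h) \<in> pverts (G \<boxtimes> K)"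
      using vu h G.in_arcsD1 G.in_arcsD2 by (auto simp: strong_product_def)
    show "(v, h) \<noteq> (u, h)"
      using vu G.pair_no_loops by force
  qed
qed

end
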